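(* Let $\mathcal{H}$ be the property of all simple ordered graphs $G$ for which there do not exist vertices $u_1<u_2\le u_3<u_4$ in $G$ such that $u_1u_2$ is a non-edge and $u_3u_4$ is an edge. For any $p=p(n)\in[0,1]$ (possibly depending on $n$), a graph $G\sim\mathbf{G}(n,p)$ satisfies with high probability $$d_1(G,\mathcal{H})=p(1-p)+o(1)\le\tfrac14+o(1).$$ That is, for every sequence $(p(n))_n$ in $[0,1]$ and every $\eta>0$, the probability that $|d_1(G,\mathcal{H})-p(n)(1-p(n))|\le\eta$ for $G\sim\mathbf{G}(n,p(n))$ tends to $1$ as $n\to\infty$; in particular $d_1(G,\mathcal{H})\le\tfrac14+\eta$ with probability tending to $1$.
   Context: A simple ordered graph on $n$ vertices is a loopless graph on $[n]$ with its natural order. $\mathbf{G}(n,p)$ is the Erdős–Rényi random graph on the ordered vertex set $[n]$, in which each pair is an edge independently with probability $p$. For ordered graphs $G,G'$ on $n$ vertices, $d_1(G,G')$ is the number of entries in which their $n\times n$ adjacency matrices differ, divided by $n^2$; $d_1(G,\mathcal{H})=\min_{G'}d_1(G,G')$ over all $G'\in\mathcal{H}$ with the same number of vertices as $G$. *)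

theory Defs
  imports "HOL-Probability.Probability"
begin

text \<open>Ordered graphs on n vertices live on the vertex set \<open>{1..n}\<close> with the order of the natural
  numbers; \<open>edges\<close> is a set of unordered pairs.\<close>

datatype ordered_graph = OGraph (num_vertices: nat) (edges: "nat set set")

definition vertex_pairs :: "nat \<Rightarrow> nat set set" where
  "vertex_pairs n = {{i, j} | i j. i \<in> {1..n} \<and> j \<in> {1..n} \<and> i \<noteq> j}"

definition simple_ordered_graph :: "ordered_graph \<Rightarrow> bool" where
  "simple_ordered_graph G \<longleftrightarrow> edges G \<subseteq> vertex_pairs (num_vertices G)"

text \<open>On the diagonal \<open>{i, j}\<close> is a singleton, which is never an edge of a simple graph.\<close>

definition adj_matrix :: "ordered_graph \<Rightarrow> nat \<Rightarrow> nat \<Rightarrow> nat" where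
  "adj_matrix G i j = (if {i, j} \<in> edges G then 1 else 0)"

text \<open>Only meant for two graphs with the same number of vertices. Entries are counted over ordered
  index pairs, so each differing edge contributes twice.\<close>

definition d1 :: "ordered_graph \<Rightarrow> ordered_graph \<Rightarrow> real" where
  "d1 G G' = (let n = num_vertices G in
     real (card {(i, j) \<in> {1..n} \<times> {1..n}. adj_matrix G i j \<noteq> adj_matrix G' i j}) / real n ^ 2)"

text \<open>The minimum is over a finite set whenever \<open>H\<close> consists of simple ordered graphs.\<close>

definition d1_to :: "ordered_graph \<Rightarrow> ordered_graph set \<Rightarrow> real" where
  "d1_to G H = Min {d1 G G' | G'. G' \<in> H \<and> num_vertices G' = num_vertices G}"

definition property_H :: "ordered_graph set" where
  "property_H = {G. simple_ordered_graph G \<and>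
     \<not> (\<exists>u1 u2 u3 u4. {u1, u2, u3, u4} \<subseteq> {1..num_vertices G} \<and>
          u1 < u2 \<and> u2 \<le> u3 \<and> u3 < u4 \<and> {u1, u2} \<notin> edges G \<and> {u3, u4} \<in> edges G)}"

definition erdos_renyi :: "nat \<Rightarrow> real \<Rightarrow> ordered_graph pmf" where
  "erdos_renyi n p =
     map_pmf (\<lambda>f. OGraph n {e \<in> vertex_pairs n. f e})
       (Pi_pmf (vertex_pairs n) False (\<lambda>_. bernoulli_pmf p))"

end

theory Submission
  imports Defs "HOL-Real_Asymp.Real_Asymp"
begin

text \<open>
  The forbidden pattern is a non-edge that ends no later than some edge begins. Cutting the vertex
  order just before the first vertex at which a non-edge ends shows that a graph avoids the pattern
  exactly if for some \<open>t\<close> the vertices \<open>1, \<dots>, t\<close> form a clique and the vertices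
  \<open>t + 1, \<dots>, n\<close> form an independent set; the pairs across the cut are unconstrained
  (\<open>property_H_iff_split\<close>). Hence the cheapest way to reach the property with a prescribed cut \<open>t\<close> is
  to add the non-edges on the left and to delete the edges on the right, which is what
  \<open>split_cost\<close> counts. Every changed pair alters two matrix entries, so
  \<open>n\<^sup>2 d\<^sub>1(G, H)\<close> is twice the least \<open>split_cost\<close>.

  In the random graph the edge counts inside the \<open>2 (n + 1)\<close> initial and final segments are
  binomial, and Hoeffding's inequality with a union bound makes all of them deviate from their means
  by less than \<open>\<epsilon> n\<^sup>2\<close>, up to probability \<open>O(n exp (- 2 \<epsilon>\<^sup>2 n\<^sup>2))\<close>. On that event
  \<open>2 / n\<^sup>2\<close> times the cost of the cut \<open>t = x n\<close> is, up to \<open>4 \<epsilon> + O(1 / n)\<close>,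
  \<open>(1 - p) x\<^sup>2 + p (1 - x)\<^sup>2 = (x - p)\<^sup>2 + p (1 - p)\<close>.
  This is at least \<open>p (1 - p)\<close> for every cut, and the cut at \<open>\<lfloor>p n\<rfloor>\<close> comes within
  \<open>1 / n\<close> of it. Finally \<open>p (1 - p) \<le> 1 / 4\<close>.
\<close>

section \<open>Pairs of vertices inside a set\<close>

definition pairs_within :: "nat set \<Rightarrow> nat set set" where
  "pairs_within A = {e. e \<subseteq> A \<and> card e = 2}"

lemma vertex_pairs_eq_pairs_within: "vertex_pairs n = pairs_within {1..n}"
  unfolding vertex_pairs_def pairs_within_def by (fastforce simp: card_2_iff)

lemma pairs_within_mono: "A \<subseteq> B \<Longrightarrow> pairs_within A \<subseteq> pairs_within B"
  unfolding pairs_within_def by auto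

lemma finite_pairs_within: "finite A \<Longrightarrow> finite (pairs_within A)"
  unfolding pairs_within_def by (rule finite_subset[of _ "Pow A"]) auto

lemma pairs_within_disjoint: "A \<inter> B = {} \<Longrightarrow> pairs_within A \<inter> pairs_within B = {}"
  unfolding pairs_within_def by (fastforce simp: card_2_iff)

lemma finite_vertex_pairs: "finite (vertex_pairs n)"
  by (simp add: vertex_pairs_eq_pairs_within finite_pairs_within)

lemma pairs_within_subset_vertex_pairs: "A \<subseteq> {1..n} \<Longrightarrow> pairs_within A \<subseteq> vertex_pairs n"
  by (simp add: vertex_pairs_eq_pairs_within pairs_within_mono)

lemma doubleton_in_pairs_within: "u < v \<Longrightarrow> {u, v} \<in> pairs_within A \<longleftrightarrow> u \<in> A \<and> v \<in> A"
  unfolding pairs_within_def by auto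

lemma pairs_withinE:
  assumes "e \<in> pairs_within A"
  obtains u v where "e = {u, v}" "u < v" "u \<in> A" "v \<in> A"
proof -
  obtain x y where "e = {x, y}" "x \<noteq> y" "x \<in> A" "y \<in> A"
    using assms by (auto simp: pairs_within_def card_2_iff)
  then show ?thesis
    by (metis insert_commute linorder_neqE_nat that)
qed

lemma two_card_pairs_within:
  assumes "finite A"
  shows "2 * real (card (pairs_within A)) = real (card A) * (real (card A) - 1)"
proof -
  have "2 * card (pairs_within A) = card A * (card A - 1)"
    unfolding pairs_within_def n_subsets[OF assms] choose_two
    by (simp add: algebra_simps)
  then have "real (2 * card (pairs_within A)) = real (card A * (card A - 1))"
    by (rule arg_cong)
  then show ?thesis
    by (cases "card A") (auto simp: algebra_simps)
qed

section \<open>The distance to the property\<close>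

text \<open>The factor 2 arises because a matrix position is an ordered pair: the fibre of the map from
  positions to unordered pairs over an edge consists of two transposed positions.\<close>

lemma card_ordered_pairs_of_edges:
  assumes "D \<subseteq> vertex_pairs n"
  shows "card {(i, j) \<in> {1..n} \<times> {1..n}. {i, j} \<in> D} = 2 * card D"
proof -
  have finD: "finite D"
    using assms finite_vertex_pairs finite_subset by blast
  have fibre: "finite {(i, j). {i, j} = e} \<and> card {(i, j). {i, j} = e} = 2" if e: "e \<in> D" for e
  proof -
    obtain a b where ab: "e = {a, b}" "a < b"
      using subsetD[OF assms e] unfolding vertex_pairs_eq_pairs_within by (rule pairs_withinE)
    have "{(i, j). {i, j} = e} = {(a, b), (b, a)}"
      unfolding ab by (auto simp: doubleton_eq_iff)
    then show ?thesis
      using ab by simp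
  qed
  have "{(i, j) \<in> {1..n} \<times> {1..n}. {i, j} \<in> D} = (\<Union>e\<in>D. {(i, j). {i, j} = e})"
    using assms by (fastforce simp: vertex_pairs_eq_pairs_within pairs_within_def)
  also have "card \<dots> = (\<Sum>e\<in>D. card {(i, j). {i, j} = e})"
    by (rule card_UN_disjoint) (use finD fibre in auto)
  also have "\<dots> = 2 * card D"
    using fibre by simp
  finally show ?thesis .
qed

lemma d1_eq_card_sym_diff:
  assumes "simple_ordered_graph G" "simple_ordered_graph G'" "num_vertices G' = num_vertices G"
  shows "d1 G G' = 2 * real (card (sym_diff (edges G) (edges G'))) / real (num_vertices G) ^ 2"
proof -
  have sub: "sym_diff (edges G) (edges G') \<subseteq> vertex_pairs (num_vertices G)"
    using assms by (auto simp: simple_ordered_graph_def)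
  have "{(i, j) \<in> {1..num_vertices G} \<times> {1..num_vertices G}. adj_matrix G i j \<noteq> adj_matrix G' i j}
      = {(i, j) \<in> {1..num_vertices G} \<times> {1..num_vertices G}. {i, j} \<in> sym_diff (edges G) (edges G')}"
    by (auto simp: adj_matrix_def split: if_splits)
  then show ?thesis
    unfolding d1_def Let_def by (simp only: card_ordered_pairs_of_edges[OF sub] of_nat_mult of_nat_numeral)
qed

text \<open>For a simple graph, the edit distance in pairs to the graphs that have the property with the
  cut \<open>t\<close>.\<close>

definition split_cost :: "ordered_graph \<Rightarrow> nat \<Rightarrow> nat" where
  "split_cost G t = card (pairs_within {1..t} - edges G)
     + card (pairs_within {t<..num_vertices G} \<inter> edges G)"

text \<open>A complete graph is cut after its last vertex. If a non-edge exists, let \<open>m\<close> be the first vertex that is the larger end of one, and cut just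
  before \<open>m\<close>. By minimality no non-edge lies on the left, and an edge on the right would form the
  forbidden pattern with the non-edge ending at \<open>m\<close>. Conversely, with a cut as described every
  non-edge ends to the right of it and every edge begins to the left of it or at it, which
  excludes the pattern.\<close>

lemma property_H_iff_split:
  "G \<in> property_H \<longleftrightarrow> simple_ordered_graph G \<and>
     (\<exists>t\<le>num_vertices G. pairs_within {1..t} \<subseteq> edges G \<and>
        pairs_within {t<..num_vertices G} \<inter> edges G = {})"
    (is "_ \<longleftrightarrow> _ \<and> (\<exists>t\<le>?n. ?split t)")
proof -
  define non_edge_ends where
    "non_edge_ends = (\<lambda>v. v \<le> ?n \<and> (\<exists>u. 1 \<le> u \<and> u < v \<and> {u, v} \<notin> edges G))"
  define forbidden where "forbidden \<longleftrightarrow> (\<exists>u1 u2 u3 u4. {u1, u2, u3, u4} \<subseteq> {1..?n} \<and>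
          u1 < u2 \<and> u2 \<le> u3 \<and> u3 < u4 \<and> {u1, u2} \<notin> edges G \<and> {u3, u4} \<in> edges G)"
  have "\<exists>t\<le>?n. ?split t" if noforb: "\<not> forbidden"
  proof (cases "\<exists>v. non_edge_ends v")
    case False
    then have "pairs_within {1..?n} \<subseteq> edges G"
      by (auto simp: non_edge_ends_def elim!: pairs_withinE)
    moreover have "pairs_within {?n<..?n} = {}"
      by (auto elim!: pairs_withinE)
    ultimately show ?thesis
      by blast
  next
    case True
    define m where "m = (LEAST v. non_edge_ends v)"
    have "non_edge_ends m"
      unfolding m_def using True by (rule LeastI_ex)
    then obtain u where u: "m \<le> ?n" "1 \<le> u" "u < m" "{u, m} \<notin> edges G"
      by (auto simp: non_edge_ends_def)
    have least: "\<not> non_edge_ends v" if "v < m" for v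
      using that not_less_Least unfolding m_def by blast
    have "pairs_within {1..m - 1} \<subseteq> edges G"
    proof
      fix e assume "e \<in> pairs_within {1..m - 1}"
      then obtain a b where ab: "e = {a, b}" "a < b" "a \<in> {1..m - 1}" "b \<in> {1..m - 1}"
        by (rule pairs_withinE)
      have "b < m" "b \<le> ?n"
        using ab u by auto
      then show "e \<in> edges G"
        using least[of b] ab by (auto simp: non_edge_ends_def)
    qed
    moreover have "pairs_within {m - 1<..?n} \<inter> edges G = {}"
    proof -
      have False if e: "e \<in> pairs_within {m - 1<..?n}" "e \<in> edges G" for e
      proof -
        obtain a b where ab: "e = {a, b}" "a < b" "a \<in> {m - 1<..?n}" "b \<in> {m - 1<..?n}"
          using e(1) by (rule pairs_withinE)
        have "{u, m, a, b} \<subseteq> {1..?n} \<and> u < m \<and> m \<le> a \<and> a < b"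
          using ab u by auto
        then have forbidden
          unfolding forbidden_def using u(4) e(2) ab(1) by blast
        then show False
          using noforb by simp
      qed
      then show ?thesis
        by blast
    qed
    moreover have "m - 1 \<le> ?n"
      using u by simp
    ultimately show ?thesis
      by blast
  qed
  moreover have "\<not> forbidden" if t: "?split t" for t
  proof
    assume forbidden
    then obtain u1 u2 u3 u4 where u: "{u1, u2, u3, u4} \<subseteq> {1..?n}" "u1 < u2" "u2 \<le> u3" "u3 < u4"
        "{u1, u2} \<notin> edges G" "{u3, u4} \<in> edges G"
      unfolding forbidden_def by blast
    show False
    proof (cases "u2 \<le> t")
      case True
      then have "{u1, u2} \<in> pairs_within {1..t}"
        using u by (simp add: doubleton_in_pairs_within)
      then show False
        using t u by blast
    next
      case False
      then have "{u3, u4} \<in> pairs_within {t<..?n}"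
        using u by (simp add: doubleton_in_pairs_within)
      then show False
        using t u by blast
    qed
  qed
  ultimately have "(\<exists>t\<le>?n. ?split t) \<longleftrightarrow> \<not> forbidden"
    by blast
  then show ?thesis
    unfolding property_H_def forbidden_def by simp
qed

text \<open>The two kinds of changes concern disjoint sets of pairs, so the cost can be compared with the
  symmetric difference of two edge sets.\<close>

lemma split_cost_eq_card_union:
  "split_cost G t = card ((pairs_within {1..t} - edges G)
     \<union> (pairs_within {t<..num_vertices G} \<inter> edges G))"
proof -
  have "pairs_within {1..t} \<inter> pairs_within {t<..num_vertices G} = {}"
    by (rule pairs_within_disjoint) auto
  then show ?thesis
    unfolding split_cost_def
    by (intro card_Un_disjoint[symmetric]) (auto simp: finite_pairs_within)
qed

text \<open>This makes the minimum in \<open>d1_to\<close> meaningful.\<close>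

lemma finite_distances_to_property_H:
  "finite {d1 G G' | G'. G' \<in> property_H \<and> num_vertices G' = n}"
proof -
  have "G' \<in> OGraph n ` Pow (vertex_pairs n)"
    if "G' \<in> property_H" "num_vertices G' = n" for G'
    using that by (cases G') (auto simp: property_H_def simple_ordered_graph_def)
  then have "{d1 G G' | G'. G' \<in> property_H \<and> num_vertices G' = n}
      \<subseteq> d1 G ` OGraph n ` Pow (vertex_pairs n)"
    by blast
  then show ?thesis
    using finite_vertex_pairs finite_subset by blast
qed

lemma ex_property_H_at_split_cost:
  assumes "simple_ordered_graph G" "t \<le> num_vertices G"
  obtains G' where "G' \<in> property_H" "num_vertices G' = num_vertices G"
    "d1 G G' = 2 * real (split_cost G t) / real (num_vertices G) ^ 2"
proof -
  let ?n = "num_vertices G"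
  let ?L = "pairs_within {1..t}" and ?R = "pairs_within {t<..?n}"
  define G' where "G' = OGraph ?n ((edges G \<union> ?L) - ?R)"
  have disj: "?L \<inter> ?R = {}"
    by (rule pairs_within_disjoint) auto
  have "?L \<subseteq> vertex_pairs ?n"
    using assms by (intro pairs_within_subset_vertex_pairs) auto
  then have simple: "simple_ordered_graph G'"
    using assms by (auto simp: G'_def simple_ordered_graph_def)
  then have "G' \<in> property_H"
    unfolding property_H_iff_split using assms disj by (auto simp: G'_def intro!: exI[of _ t])
  moreover have "sym_diff (edges G) (edges G') = (?L - edges G) \<union> (?R \<inter> edges G)"
    using disj by (auto simp: G'_def)
  then have "d1 G G' = 2 * real (split_cost G t) / real ?n ^ 2"
    using d1_eq_card_sym_diff[OF assms(1) simple] by (simp add: split_cost_eq_card_union G'_def)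
  ultimately show ?thesis
    using that[of G'] by (simp add: G'_def)
qed

lemma d1_to_property_H_le:
  assumes "simple_ordered_graph G" "t \<le> num_vertices G"
  shows "d1_to G property_H \<le> 2 * real (split_cost G t) / real (num_vertices G) ^ 2"
proof -
  obtain G' where G': "G' \<in> property_H" "num_vertices G' = num_vertices G"
      "d1 G G' = 2 * real (split_cost G t) / real (num_vertices G) ^ 2"
    using ex_property_H_at_split_cost[OF assms] by metis
  have "d1_to G property_H \<le> d1 G G'"
    unfolding d1_to_def using G' by (intro Min_le finite_distances_to_property_H) blast
  then show ?thesis
    unfolding G'(3) .
qed

text \<open>A nearest graph with the property has a cut \<open>t\<close> of its own, and \<open>G\<close> differs from it in every
  non-edge on the left and every edge on the right of that cut.\<close>

lemma d1_to_property_H_attained: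
  assumes "simple_ordered_graph G"
  obtains t where "t \<le> num_vertices G"
    "2 * real (split_cost G t) / real (num_vertices G) ^ 2 \<le> d1_to G property_H"
proof -
  let ?n = "num_vertices G"
  obtain G0 where "G0 \<in> property_H" "num_vertices G0 = ?n"
    by (rule ex_property_H_at_split_cost[OF assms, of 0]) auto
  then have "{d1 G G' | G'. G' \<in> property_H \<and> num_vertices G' = ?n} \<noteq> {}"
    by blast
  then have "d1_to G property_H \<in> {d1 G G' | G'. G' \<in> property_H \<and> num_vertices G' = ?n}"
    unfolding d1_to_def by (rule Min_in[OF finite_distances_to_property_H])
  then obtain G' where G': "G' \<in> property_H" "num_vertices G' = ?n" "d1_to G property_H = d1 G G'"
    by blast
  then obtain t where t: "t \<le> ?n" "pairs_within {1..t} \<subseteq> edges G'"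
      "pairs_within {t<..?n} \<inter> edges G' = {}" and simple: "simple_ordered_graph G'"
    by (auto simp: property_H_iff_split)
  have "finite (sym_diff (edges G) (edges G'))"
    using assms simple G'(2)
    by (intro finite_subset[OF _ finite_vertex_pairs[of ?n]]) (auto simp: simple_ordered_graph_def)
  then have "split_cost G t \<le> card (sym_diff (edges G) (edges G'))"
    unfolding split_cost_eq_card_union using t by (intro card_mono) auto
  then have "2 * real (split_cost G t) / real ?n ^ 2 \<le> d1_to G property_H"
    unfolding G'(3) d1_eq_card_sym_diff[OF assms simple G'(2)]
    by (intro divide_right_mono) auto
  then show ?thesis
    using that t by blast
qed

section \<open>Concentration of the edge counts\<close>

lemma simple_if_in_erdos_renyi:
  "G \<in> set_pmf (erdos_renyi n p) \<Longrightarrow> num_vertices G = n \<and> simple_ordered_graph G"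
  by (auto simp: erdos_renyi_def simple_ordered_graph_def)

lemma edge_count_binomial:
  assumes "S \<subseteq> vertex_pairs n" "p \<in> {0..1}"
  shows "map_pmf (\<lambda>G. card (S \<inter> edges G)) (erdos_renyi n p) = binomial_pmf (card S) p"
proof -
  have "binomial_pmf (card S) p
      = map_pmf (\<lambda>f. card {e \<in> S. f e}) (Pi_pmf S False (\<lambda>_. bernoulli_pmf p))"
    using assms finite_subset[OF assms(1) finite_vertex_pairs]
    by (intro binomial_pmf_altdef') auto
  also have "\<dots> = map_pmf (\<lambda>f. card {e \<in> S. if e \<in> S then f e else False})
      (Pi_pmf (vertex_pairs n) False (\<lambda>_. bernoulli_pmf p))"
    unfolding Pi_pmf_subset[OF finite_vertex_pairs assms(1)] by (simp add: map_pmf_comp)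
  also have "\<dots> = map_pmf (\<lambda>G. card (S \<inter> edges G)) (erdos_renyi n p)"
    unfolding erdos_renyi_def map_pmf_comp using assms(1)
    by (intro map_pmf_cong refl arg_cong[of _ _ card]) auto
  finally show ?thesis ..
qed

text \<open>Hoeffding's bound decreases with the number of trials, so replacing \<open>card S\<close> by its upper
  bound \<open>n\<^sup>2\<close> gives an estimate that is uniform in \<open>S\<close> and hence suits a union bound.\<close>

lemma edge_count_tail:
  assumes S: "S \<subseteq> vertex_pairs n" and p: "p \<in> {0..1}" and "n > 0" "\<epsilon> > 0"
  shows "measure_pmf.prob (erdos_renyi n p)
      {G. \<bar>real (card (S \<inter> edges G)) - real (card S) * p\<bar> \<ge> \<epsilon> * real n ^ 2}
    \<le> 2 * exp (- 2 * \<epsilon> ^ 2 * real n ^ 2)" (is "?prob \<le> _")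
proof (cases "card S = 0")
  case True
  \<comment> \<open>Hoeffding's inequality in the binomial form needs at least one trial; without trials there is
    no deviation.\<close>
  have "finite S"
    using S finite_vertex_pairs finite_subset by blast
  then have "{G. \<bar>real (card (S \<inter> edges G)) - real (card S) * p\<bar> \<ge> \<epsilon> * real n ^ 2} = {}"
    using True assms by (auto simp: not_le)
  then show ?thesis
    by simp
next
  case False
  have "card S \<le> card (vertex_pairs n)"
    using S finite_vertex_pairs by (intro card_mono)
  also have "2 * real \<dots> \<le> 2 * real n ^ 2"
    using two_card_pairs_within[of "{1..n}"]
    by (simp add: vertex_pairs_eq_pairs_within power2_eq_square algebra_simps)
  finally have S_le: "real (card S) \<le> real n ^ 2"
    by simp
  interpret binomial_distribution "card S" p
    using p by unfold_locales
  have "?prob = measure_pmf.prob (binomial_pmf (card S) p)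
      {x. \<bar>real x - real (card S) * p\<bar> \<ge> \<epsilon> * real n ^ 2}"
    unfolding edge_count_binomial[OF S p, symmetric] by (simp add: vimage_def)
  also have "\<dots> \<le> 2 * exp (- 2 * (\<epsilon> * real n ^ 2) ^ 2 / real (card S))"
    using False assms by (intro prob_abs_ge) auto
  also have "\<dots> \<le> 2 * exp (- 2 * \<epsilon> ^ 2 * real n ^ 2)"
  proof -
    have "2 * \<epsilon> ^ 2 * real n ^ 2 * real (card S) \<le> 2 * \<epsilon> ^ 2 * real n ^ 2 * real n ^ 2"
      using S_le by (intro mult_left_mono) auto
    also have "\<dots> = 2 * (\<epsilon> * real n ^ 2) ^ 2"
      by (simp add: power2_eq_square)
    finally have "2 * \<epsilon> ^ 2 * real n ^ 2 \<le> 2 * (\<epsilon> * real n ^ 2) ^ 2 / real (card S)"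
      using False by (simp add: pos_le_divide_eq)
    then show ?thesis
      by simp
  qed
  finally show ?thesis .
qed

definition edge_counts_close :: "real \<Rightarrow> real \<Rightarrow> nat set set set \<Rightarrow> ordered_graph \<Rightarrow> bool" where
  "edge_counts_close \<epsilon> p \<S> G \<longleftrightarrow> (\<forall>S\<in>\<S>.
     \<bar>real (card (S \<inter> edges G)) - real (card S) * p\<bar> < \<epsilon> * real (num_vertices G) ^ 2)"

lemma prob_edge_counts_close:
  assumes \<S>: "finite \<S>" "\<S> \<subseteq> Pow (vertex_pairs n)" and "p \<in> {0..1}" "n > 0" "\<epsilon> > 0"
  shows "measure_pmf.prob (erdos_renyi n p) {G. edge_counts_close \<epsilon> p \<S> G}
    \<ge> 1 - real (card \<S>) * (2 * exp (- 2 * \<epsilon> ^ 2 * real n ^ 2))"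
proof -
  let ?P = "erdos_renyi n p"
  let ?bad = "\<lambda>S. {G. \<bar>real (card (S \<inter> edges G)) - real (card S) * p\<bar> \<ge> \<epsilon> * real n ^ 2}"
  have "measure_pmf.prob ?P {G. edge_counts_close \<epsilon> p \<S> G}
      = measure_pmf.prob ?P (- (\<Union>S\<in>\<S>. ?bad S))"
    by (rule measure_pmf.finite_measure_eq_AE)
      (auto simp: AE_measure_pmf_iff edge_counts_close_def not_le dest!: simple_if_in_erdos_renyi)
  also have "\<dots> = 1 - measure_pmf.prob ?P (\<Union>S\<in>\<S>. ?bad S)"
    using measure_pmf.prob_compl[of "\<Union>S\<in>\<S>. ?bad S" ?P] by (simp add: Compl_eq_Diff_UNIV)
  finally have compl: "measure_pmf.prob ?P {G. edge_counts_close \<epsilon> p \<S> G}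
      = 1 - measure_pmf.prob ?P (\<Union>S\<in>\<S>. ?bad S)" .
  have "measure_pmf.prob ?P (\<Union>S\<in>\<S>. ?bad S) \<le> (\<Sum>S\<in>\<S>. measure_pmf.prob ?P (?bad S))"
    using \<S> by (intro measure_UNION_le) auto
  also have "\<dots> \<le> (\<Sum>S\<in>\<S>. 2 * exp (- 2 * \<epsilon> ^ 2 * real n ^ 2))"
    using assms by (intro sum_mono edge_count_tail) auto
  finally show ?thesis
    unfolding compl by simp
qed

text \<open>The sets of pairs whose edge counts determine every \<open>split_cost\<close>.\<close>

definition split_pairs :: "nat \<Rightarrow> nat set set set" where
  "split_pairs n = (\<lambda>t. pairs_within {1..t}) ` {..n} \<union> (\<lambda>t. pairs_within {t<..n}) ` {..n}"

lemma card_split_pairs_le: "card (split_pairs n) \<le> 2 * (n + 1)"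
proof -
  have "card (split_pairs n) \<le> card ((\<lambda>t. pairs_within {1..t}) ` {..n})
      + card ((\<lambda>t. pairs_within {t<..n}) ` {..n})"
    unfolding split_pairs_def by (rule card_Un_le)
  also have "\<dots> \<le> card {..n} + card {..n}"
    by (intro add_mono card_image_le) auto
  finally show ?thesis
    by simp
qed

section \<open>The distance of the random graph\<close>

text \<open>The mean of \<open>2 split_cost G t\<close> is \<open>(1 - p) t (t - 1) + p (n - t) (n - t - 1)\<close>. Its quadratic part
  is \<open>n\<^sup>2\<close> times \<open>(1 - p) x\<^sup>2 + p (1 - x)\<^sup>2\<close> with \<open>x = t / n\<close>, and completing the square gives
  \<open>(x - p)\<^sup>2 + p (1 - p)\<close>. Its linear part is at most \<open>n\<close>, which yields the error \<open>1 / n\<close>. Each of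
  the two edge counts enters with factor 2 and deviates by at most \<open>\<epsilon> n\<^sup>2\<close>, which yields
  \<open>4 \<epsilon>\<close>.\<close>

lemma split_cost_close_to_quadratic:
  assumes close: "edge_counts_close \<epsilon> p (split_pairs n) G"
    and n: "num_vertices G = n" "n > 0" and p: "p \<in> {0..1}" and t: "t \<le> n"
  shows "\<bar>2 * real (split_cost G t) / real n ^ 2 - ((real t / real n - p) ^ 2 + p * (1 - p))\<bar>
    \<le> 4 * \<epsilon> + 1 / real n"
proof -
  let ?L = "pairs_within {1..t}" and ?R = "pairs_within {t<..n}"
  define cL cR eL eR where "cL = real (card ?L)" "cR = real (card ?R)"
    "eL = real (card (?L \<inter> edges G))" "eR = real (card (?R \<inter> edges G))"
  note defs = this
  have dev_L: "\<bar>eL - cL * p\<bar> < \<epsilon> * real n ^ 2" and dev_R: "\<bar>eR - cR * p\<bar> < \<epsilon> * real n ^ 2"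
    using close t n unfolding edge_counts_close_def split_pairs_def defs by auto
  have cL: "2 * cL = real t * (real t - 1)"
    using two_card_pairs_within[of "{1..t}"] by (simp add: defs)
  have cR: "2 * cR = (real n - real t) * (real n - real t - 1)"
    using two_card_pairs_within[of "{t<..n}"] t by (simp add: defs)
  have "real (card (?L - edges G)) = cL - eL"
    unfolding defs by (simp add: card_Diff_subset_Int finite_pairs_within card_mono)
  then have cost: "real (split_cost G t) = cL - eL + eR"
    using n by (simp add: split_cost_def defs)
  define quad where "quad = (real t / real n - p) ^ 2 + p * (1 - p)"
  define lin where "lin = (1 - p) * real t + p * (real n - real t)"
  have "real n ^ 2 * quad = (1 - p) * real t ^ 2 + p * (real n - real t) ^ 2"
    using n by (simp add: quad_def field_simps power2_eq_square)
  also have "\<dots> = (1 - p) * (2 * cL) + p * (2 * cR) + lin"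
    unfolding cL cR lin_def by (simp add: algebra_simps power2_eq_square)
  finally have "2 * real (split_cost G t) - real n ^ 2 * quad
      = 2 * (eR - cR * p) - 2 * (eL - cL * p) - lin"
    unfolding cost by (simp add: algebra_simps)
  moreover have "lin \<ge> 0"
    unfolding lin_def using p t by simp
  moreover have "lin \<le> (1 - p) * real n + p * real n"
    unfolding lin_def using p t by (intro add_mono mult_left_mono) auto
  then have "lin \<le> real n"
    by (simp add: algebra_simps)
  ultimately have "\<bar>2 * real (split_cost G t) - real n ^ 2 * quad\<bar> \<le> 4 * (\<epsilon> * real n ^ 2) + real n"
    using dev_L dev_R by (simp only: abs_less_iff abs_le_iff) argo
  then have "\<bar>2 * real (split_cost G t) - real n ^ 2 * quad\<bar> / real n ^ 2
      \<le> (4 * (\<epsilon> * real n ^ 2) + real n) / real n ^ 2"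
    by (intro divide_right_mono) auto
  also have "\<dots> = 4 * \<epsilon> + 1 / real n"
    using n by (simp add: field_simps power2_eq_square)
  also have "\<bar>2 * real (split_cost G t) - real n ^ 2 * quad\<bar> / real n ^ 2
      = \<bar>(2 * real (split_cost G t) - real n ^ 2 * quad) / real n ^ 2\<bar>"
    by simp
  also have "(2 * real (split_cost G t) - real n ^ 2 * quad) / real n ^ 2
      = 2 * real (split_cost G t) / real n ^ 2 - quad"
    using n by (simp add: diff_divide_distrib)
  finally show ?thesis
    unfolding quad_def .
qed

text \<open>Every cut costs at least the constant term \<open>p (1 - p)\<close>, up to the error. For the upper bound
  the best real cut \<open>x = p\<close> is rounded down to a multiple of \<open>1 / n\<close>, which adds at most
  \<open>1 / n\<^sup>2 \<le> 1 / n\<close>.\<close>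

lemma d1_to_property_H_close:
  assumes close: "edge_counts_close \<epsilon> p (split_pairs n) G" and simple: "simple_ordered_graph G"
    and n: "num_vertices G = n" "n > 0" and p: "p \<in> {0..1}"
  shows "\<bar>d1_to G property_H - p * (1 - p)\<bar> \<le> 4 * \<epsilon> + 2 / real n"
proof -
  note cost = split_cost_close_to_quadratic[OF close n p]
  obtain t where t: "t \<le> n" "2 * real (split_cost G t) / real n ^ 2 \<le> d1_to G property_H"
    using d1_to_property_H_attained[OF simple] n by blast
  have "(real t / real n - p) ^ 2 \<ge> 0"
    by simp
  moreover have "1 / real n \<le> 2 / real n"
    by (simp add: divide_right_mono)
  ultimately have lower: "p * (1 - p) - (4 * \<epsilon> + 2 / real n) \<le> d1_to G property_H"
    using cost[OF t(1)] t(2) by linarith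
  define s where "s = nat \<lfloor>p * real n\<rfloor>"
  have s_le: "real s \<le> p * real n" and s_gt: "p * real n < real s + 1"
    using p unfolding s_def by (auto intro: of_nat_floor)
  have "p * real n \<le> real n"
    using p by (simp add: mult_left_le_one_le)
  then have s: "s \<le> n"
    using s_le by linarith
  have "real s / real n - p = (real s - p * real n) / real n"
    using n by (simp add: diff_divide_distrib)
  then have "\<bar>real s / real n - p\<bar> = \<bar>real s - p * real n\<bar> / real n"
    by simp
  also have "\<dots> \<le> 1 / real n"
    using s_le s_gt by (intro divide_right_mono) auto
  finally have "\<bar>real s / real n - p\<bar> ^ 2 \<le> (1 / real n) ^ 2"
    by (intro power_mono) auto
  also have "(1 / real n) ^ 2 \<le> 1 / real n"
    using n by (simp add: field_simps power2_eq_square)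
  finally have "(real s / real n - p) ^ 2 \<le> 1 / real n"
    by simp
  moreover have "2 / real n = 1 / real n + 1 / real n"
    by simp
  moreover have "d1_to G property_H \<le> 2 * real (split_cost G s) / real n ^ 2"
    using d1_to_property_H_le[OF simple, of s] s n by simp
  ultimately have upper: "d1_to G property_H \<le> p * (1 - p) + (4 * \<epsilon> + 2 / real n)"
    using cost[OF s] by linarith
  from lower upper show ?thesis
    by linarith
qed

text \<open>The tolerance \<open>\<eta>\<close> is shared equally: \<open>\<epsilon> = \<eta> / 8\<close> leaves \<open>4 \<epsilon> = \<eta> / 2\<close> for the random deviations,
  and \<open>n \<ge> 4 / \<eta>\<close> leaves \<open>2 / n \<le> \<eta> / 2\<close> for the
  terms of lower order.\<close>

lemma prob_d1_to_property_H_close: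
  assumes p: "p \<in> {0..1}" and n: "n > 0" "4 / \<eta> \<le> real n" and \<eta>: "\<eta> > 0"
  shows "measure_pmf.prob (erdos_renyi n p) {G. \<bar>d1_to G property_H - p * (1 - p)\<bar> \<le> \<eta>}
    \<ge> 1 - 4 * (real n + 1) * exp (- 2 * (\<eta> / 8) ^ 2 * real n ^ 2)"
proof -
  let ?\<epsilon> = "\<eta> / 8"
  have "2 / real n \<le> \<eta> / 2"
    using n \<eta> by (simp add: field_simps)
  then have tol: "4 * ?\<epsilon> + 2 / real n \<le> \<eta>"
    by simp
  have "pairs_within {1..t} \<subseteq> vertex_pairs n" "pairs_within {t<..n} \<subseteq> vertex_pairs n" if "t \<le> n" for t
    using that by (intro pairs_within_subset_vertex_pairs; auto)+
  then have "split_pairs n \<subseteq> Pow (vertex_pairs n)"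
    unfolding split_pairs_def by blast
  moreover have "finite (split_pairs n)"
    by (simp add: split_pairs_def)
  ultimately have "1 - real (card (split_pairs n)) * (2 * exp (- 2 * ?\<epsilon> ^ 2 * real n ^ 2))
      \<le> measure_pmf.prob (erdos_renyi n p) {G. edge_counts_close ?\<epsilon> p (split_pairs n) G}"
    using assms by (intro prob_edge_counts_close) auto
  also have "\<dots> \<le> measure_pmf.prob (erdos_renyi n p) {G. \<bar>d1_to G property_H - p * (1 - p)\<bar> \<le> \<eta>}"
  proof (rule measure_pmf.finite_measure_mono_AE)
    have "\<bar>d1_to G property_H - p * (1 - p)\<bar> \<le> \<eta>"
      if "G \<in> set_pmf (erdos_renyi n p)" "edge_counts_close ?\<epsilon> p (split_pairs n) G" for G
      using d1_to_property_H_close[OF that(2) _ _ n(1) p] simple_if_in_erdos_renyi[OF that(1)] tol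
      by linarith
    then show "AE G in erdos_renyi n p. G \<in> {G. edge_counts_close ?\<epsilon> p (split_pairs n) G}
        \<longrightarrow> G \<in> {G. \<bar>d1_to G property_H - p * (1 - p)\<bar> \<le> \<eta>}"
      by (simp add: AE_measure_pmf_iff)
  qed simp
  finally have "1 - real (card (split_pairs n)) * (2 * exp (- 2 * ?\<epsilon> ^ 2 * real n ^ 2))
      \<le> measure_pmf.prob (erdos_renyi n p) {G. \<bar>d1_to G property_H - p * (1 - p)\<bar> \<le> \<eta>}" .
  moreover have "real (card (split_pairs n)) * (2 * exp (- 2 * ?\<epsilon> ^ 2 * real n ^ 2))
      \<le> (2 * (real n + 1)) * (2 * exp (- 2 * ?\<epsilon> ^ 2 * real n ^ 2))"
    using card_split_pairs_le[of n] by (intro mult_right_mono) auto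
  ultimately show ?thesis
    by (simp add: algebra_simps)
qed

theorem lemma7p2:
  fixes p :: "nat \<Rightarrow> real" and \<eta> :: real
  assumes "\<And>n. 0 \<le> p n \<and> p n \<le> 1" and "\<eta> > 0"
  shows "(\<lambda>n. measure_pmf.prob (erdos_renyi n (p n))
            {G. \<bar>d1_to G property_H - p n * (1 - p n)\<bar> \<le> \<eta>}) \<longlonglongrightarrow> 1
       \<and> (\<lambda>n. measure_pmf.prob (erdos_renyi n (p n))
            {G. d1_to G property_H \<le> 1 / 4 + \<eta>}) \<longlonglongrightarrow> 1"
proof
  let ?close = "\<lambda>n. measure_pmf.prob (erdos_renyi n (p n))
    {G. \<bar>d1_to G property_H - p n * (1 - p n)\<bar> \<le> \<eta>}"
  define c where "c = 2 * (\<eta> / 8) ^ 2"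
  have "c > 0"
    using assms(2) by (simp add: c_def)
  then have bound: "(\<lambda>n. 1 - 4 * (real n + 1) * exp (- c * real n ^ 2)) \<longlonglongrightarrow> 1"
    by real_asymp
  have "\<forall>\<^sub>F n in sequentially. 4 / \<eta> \<le> real n"
    using filterlim_real_sequentially by (simp add: filterlim_at_top)
  then have "\<forall>\<^sub>F n in sequentially. 1 - 4 * (real n + 1) * exp (- c * real n ^ 2) \<le> ?close n"
    using eventually_gt_at_top[of 0]
  proof eventually_elim
    case (elim n)
    have "p n \<in> {0..1}"
      using assms(1)[of n] by simp
    from prob_d1_to_property_H_close[OF this elim(2,1) assms(2)] show ?case
      by (simp add: c_def)
  qed
  then show lim: "?close \<longlonglongrightarrow> 1"
    by (rule tendsto_sandwich[OF _ _ bound tendsto_const]) auto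
  have "?close n \<le> measure_pmf.prob (erdos_renyi n (p n)) {G. d1_to G property_H \<le> 1 / 4 + \<eta>}" for n
  proof (rule measure_pmf.finite_measure_mono)
    have "0 \<le> (p n - 1 / 2) ^ 2"
      by simp
    then have "p n * (1 - p n) \<le> 1 / 4"
      by (simp add: power2_eq_square algebra_simps)
    then show "{G. \<bar>d1_to G property_H - p n * (1 - p n)\<bar> \<le> \<eta>}
        \<subseteq> {G. d1_to G property_H \<le> 1 / 4 + \<eta>}"
      by auto
  qed simp
  then show "(\<lambda>n. measure_pmf.prob (erdos_renyi n (p n))
      {G. d1_to G property_H \<le> 1 / 4 + \<eta>}) \<longlonglongrightarrow> 1"
    by (intro tendsto_sandwich[OF _ _ lim tendsto_const]) auto
qed

end
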